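(* Let $X,Y,\sigma,\omega,f=(f_1,\dots,f_r)$ and $\xi_1,\dots,\xi_m$ be as in the context. Let $\mathcal{N}\subset\mathbb{Z}[x_1,\dots,x_r]$ be an $f$-admissible free $\mathbb{Z}$-module of infinite rank with an increasing exhaustive filtration by submodules $\mathcal{N}_n$ of finite rank $N=N_n$, and let $e_n^{\mathcal{N}}$ be exponents. For each $n$ let $Q^\sigma_N$ be the $N\times N$ matrix associated to $\mathcal{N}_n$, let $D^\ell_N,D^r_N\in\mathrm{GL}_N(\mathbb{Q})$ be matrices such that all entries of $D^\ell_NQ^\sigma_ND^r_N$ lie in $\mathbb{Z}\xi_1+\cdots+\mathbb{Z}\xi_m$, let $\delta_N=|\det(D^\ell_N)\det(D^r_N)|$ and $$\delta_{\mathcal{N}}=\limsup_{n\to\infty}\delta_{N_n}^{1/e_n^{\mathcal{N}}}.$$ Suppose that $\det Q^\sigma_N\ne0$ for infinitely many values of $N=N_n$. If $$\mathrm{Sup}_{\mathcal{N}}(f(\sigma))^2\,\delta_{\mathcal{N}}<1$$ (both factors being finite), then $\dim_{\mathbb{Q}}(\mathbb{Q}\xi_1+\cdots+\mathbb{Q}\xi_m)\ge2$. In particular, if $m=2$ and $\xi_1=1$, then $\xi_2$ is irrational.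
   Context: Setting: $X$ is a smooth affine algebraic variety of dimension $d$ over $\mathbb{Q}$; $\omega$ is a regular differential $d$-form on $X$; $Y\subset X$ is a divisor over $\mathbb{Q}$; $\sigma\subset X(\mathbb{C})$ is a (compact) relative $d$-chain with boundary contained in $Y(\mathbb{C})$; $f=(f_1,\dots,f_r):X\to\mathbb{A}^r$ is a morphism over $\mathbb{Q}$. The integrals $I(n_1,\dots,n_r)=\int_\sigma f_1^{n_1}\cdots f_r^{n_r}\,\omega$ (integers $n_i\ge0$) are assumed real, and $\xi_1,\dots,\xi_m$ are fixed periods such that $I(n_1,\dots,n_r)\in\mathbb{Q}\xi_1+\cdots+\mathbb{Q}\xi_m$ for all integers $n_i\ge0$. A free $\mathbb{Z}$-module $\mathcal{N}\subset\mathbb{Z}[x_1,\dots,x_r]$ is $f$-admissible if $\mathfrak{m}\mapsto\mathfrak{m}\circ f$ is injective on $\mathcal{N}$. If $\mathcal{N}_n$ has basis $\mathfrak{m}_1,\dots,\mathfrak{m}_N$, put $\mathfrak{f}_i=\mathfrak{m}_i\circ f$ and $Q^\sigma_N=\left(\int_\sigma\mathfrak{f}_i\mathfrak{f}_j\,\omega\right)_{1\le i,j\le N}$. Exponents are a sequence of natural numbers $e_n^{\mathcal{N}}$ (positive for large $n$). For $\tau\subset\mathbb{C}^r$, $$t_{\mathcal{N}_n}(\tau)=\sup_{(z_1,\dots,z_N)\in\tau^N}\left|\det(\mathfrak{m}_j(z_i))_{1\le i,j\le N}\right|,\qquad\mathrm{Sup}_{\mathcal{N}}(\tau)=\limsup_{n\to\infty}\left(t_{\mathcal{N}_n}(\tau)\right)^{1/e_n^{\mathcal{N}}}.$$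 *)

theory Defs
  imports
    "HOL-Analysis.Analysis"
    "HOL-Homology.Homology"
    "Jordan_Normal_Form.Determinant"
begin

(* Both the Cartesian vectors of HOL-Analysis and the vectors and matrices of Jordan_Normal_Form
   are in scope; the former are indexed with vec_nth, and all determinants are Determinant.det,
   whose size may vary with a natural number. *)

section \<open>Linear algebra over the integers and the rationals\<close>

abbreviation int_scale :: "int \<Rightarrow> 'a::comm_ring_1 \<Rightarrow> 'a" where
  "int_scale k x \<equiv> of_int k * x"

abbreviation rat_scale :: "rat \<Rightarrow> complex \<Rightarrow> complex" where
  "rat_scale q z \<equiv> of_rat q * z"

lemma module_int_scale: "Modules.module (int_scale :: int \<Rightarrow> 'a::comm_ring_1 \<Rightarrow> 'a)"
  by unfold_locales (simp_all add: algebra_simps)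

lemma vector_space_rat_scale: "Vector_Spaces.vector_space rat_scale"
  by unfold_locales (simp_all add: algebra_simps of_rat_add of_rat_mult)

abbreviation int_submodule :: "'a::comm_ring_1 set \<Rightarrow> bool" where
  "int_submodule \<equiv> Modules.module.subspace int_scale"

abbreviation int_span :: "'a::comm_ring_1 set \<Rightarrow> 'a set" where
  "int_span \<equiv> Modules.module.span int_scale"

definition int_basis :: "'a::comm_ring_1 set \<Rightarrow> 'a set \<Rightarrow> bool" where
  "int_basis B M \<longleftrightarrow> \<not> Modules.module.dependent int_scale B \<and> int_span B = M"

abbreviation rat_span :: "complex set \<Rightarrow> complex set" where
  "rat_span \<equiv> Modules.module.span rat_scale"

abbreviation rat_dim :: "complex set \<Rightarrow> nat" where
  "rat_dim \<equiv> Vector_Spaces.vector_space.dim rat_scale"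


section \<open>Multivariate polynomials\<close>

(* The monoid algebra of the monomials; multiplication is the convolution product. *)
type_synonym ('i, 'a) mpoly = "('i \<Rightarrow>\<^sub>0 nat) \<Rightarrow>\<^sub>0 'a"

(* Evaluation at y, with the coefficients mapped along c. *)
definition mpeval :: "('a::zero \<Rightarrow> 'b::comm_semiring_1) \<Rightarrow> ('i, 'a) mpoly \<Rightarrow> ('i \<Rightarrow> 'b) \<Rightarrow> 'b" where
  "mpeval c p y =
     (\<Sum>\<mu>\<in>Poly_Mapping.keys p. c (Poly_Mapping.lookup p \<mu>) *
        (\<Prod>i\<in>Poly_Mapping.keys \<mu>. y i ^ Poly_Mapping.lookup \<mu> i))"

abbreviation rat_eval :: "('k::finite, rat) mpoly \<Rightarrow> complex ^ 'k \<Rightarrow> complex" where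
  "rat_eval p y \<equiv> mpeval of_rat p (vec_nth y)"

abbreviation int_eval :: "('r::finite, int) mpoly \<Rightarrow> complex ^ 'r \<Rightarrow> complex" where
  "int_eval p y \<equiv> mpeval of_int p (vec_nth y)"


section \<open>Affine varieties over the rationals\<close>

(* An affine variety over Q (reduced, not necessarily irreducible) is presented as a closed
   subvariety of an affine space over Q and identified with its set of complex points. *)
definition affine_variety :: "(complex ^ 'k::finite) set \<Rightarrow> bool" where
  "affine_variety X \<longleftrightarrow> (\<exists>S :: ('k, rat) mpoly set. X = {y. \<forall>p\<in>S. rat_eval p y = 0})"

definition vanishing_ideal :: "(complex ^ 'k::finite) set \<Rightarrow> ('k, rat) mpoly set" where
  "vanishing_ideal X = {p. \<forall>y\<in>X. rat_eval p y = 0}"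

definition irreducible_variety :: "(complex ^ 'k::finite) set \<Rightarrow> bool" where
  "irreducible_variety Z \<longleftrightarrow> affine_variety Z \<and> Z \<noteq> {} \<and>
     (\<forall>A B. affine_variety A \<and> affine_variety B \<and> Z = A \<union> B \<longrightarrow> Z = A \<or> Z = B)"

definition krull_chain :: "nat \<Rightarrow> (complex ^ 'k::finite) set \<Rightarrow> (nat \<Rightarrow> (complex ^ 'k) set) \<Rightarrow> bool" where
  "krull_chain n Z C \<longleftrightarrow>
     (\<forall>i\<le>n. irreducible_variety (C i) \<and> C i \<subseteq> Z) \<and> (\<forall>i<n. C i \<subset> C (Suc i))"

definition has_dimension :: "(complex ^ 'k::finite) set \<Rightarrow> nat \<Rightarrow> bool" where
  "has_dimension Z d \<longleftrightarrow>
     (\<exists>C. krull_chain d Z C) \<and> (\<forall>n C. krull_chain n Z C \<longrightarrow> n \<le> d)"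

definition irreducible_component :: "(complex ^ 'k::finite) set \<Rightarrow> (complex ^ 'k) set \<Rightarrow> bool" where
  "irreducible_component Z Y \<longleftrightarrow> irreducible_variety Z \<and> Z \<subseteq> Y \<and>
     (\<forall>Z'. irreducible_variety Z' \<and> Z \<subseteq> Z' \<and> Z' \<subseteq> Y \<longrightarrow> Z' = Z)"

(* The Zariski tangent space at y: the kernel of all differentials dp(y) with p in the ideal of X;
   dp(y)(v) is written as the derivative of p along the line y + t v. *)
definition tangent_space :: "(complex ^ 'k::finite) set \<Rightarrow> complex ^ 'k \<Rightarrow> (complex ^ 'k) set" where
  "tangent_space X y =
     {v. \<forall>p\<in>vanishing_ideal X. deriv (\<lambda>t. rat_eval p (y + t *s v)) 0 = 0}"

(* Jacobian criterion. The variety is required to have the same dimension d at every point. *)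
definition smooth_affine_variety :: "nat \<Rightarrow> (complex ^ 'k::finite) set \<Rightarrow> bool" where
  "smooth_affine_variety d X \<longleftrightarrow> affine_variety X \<and> has_dimension X d \<and>
     (\<forall>y\<in>X. vec.dim (tangent_space X y) = d)"

(* The support of an effective divisor; the zero divisor (empty support) is allowed. *)
definition divisor :: "nat \<Rightarrow> (complex ^ 'k::finite) set \<Rightarrow> (complex ^ 'k) set \<Rightarrow> bool" where
  "divisor d X Y \<longleftrightarrow> affine_variety Y \<and> Y \<subseteq> X \<and>
     (\<forall>Z. irreducible_component Z Y \<longrightarrow> (\<exists>e. has_dimension Z e \<and> Suc e = d))"

definition regular_morphism ::
    "(complex ^ 'k::finite) set \<Rightarrow> (complex ^ 'k \<Rightarrow> complex ^ 'r::finite) \<Rightarrow> bool" where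
  "regular_morphism X f \<longleftrightarrow>
     (\<exists>F :: 'r \<Rightarrow> ('k, rat) mpoly. \<forall>y\<in>X. \<forall>i. vec_nth (f y) i = rat_eval (F i) y)"


section \<open>Differential forms and their integrals\<close>

(* A d-form assigns to a point y and a list of d tangent vectors at y a complex number.  Since X is
   closed in affine space, the regular d-forms over Q are the restrictions of the polynomial forms
   sum_J a_J dy_(J1) /\ ... /\ dy_(Jd), with multi-indices J of length d.  Only the values on
   tangent vectors of X at points of X are meaningful. *)
type_synonym 'k form = "complex ^ 'k \<Rightarrow> (complex ^ 'k) list \<Rightarrow> complex"

definition regular_form :: "nat \<Rightarrow> (complex ^ 'k::finite) set \<Rightarrow> 'k form \<Rightarrow> bool" where
  "regular_form d X \<omega> \<longleftrightarrow>
     (\<exists>a :: 'k list \<Rightarrow> ('k, rat) mpoly.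
        \<forall>y\<in>X. \<forall>vs. length vs = d \<and> set vs \<subseteq> tangent_space X y \<longrightarrow>
          \<omega> y vs = (\<Sum>J | length J = d.
             rat_eval (a J) y * Determinant.det (mat d d (\<lambda>(i, j). vec_nth (vs ! i) (J ! j)))))"

definition fun_times_form :: "(complex ^ 'k \<Rightarrow> complex) \<Rightarrow> 'k::finite form \<Rightarrow> 'k form" where
  "fun_times_form g \<omega> = (\<lambda>y vs. g y * \<omega> y vs)"

(* On the standard simplex x_0 + ... + x_d = 1 we use the coordinates x_1, ..., x_d, so the j-th
   coordinate direction is e_j - e_0. *)
definition simplex_point :: "nat \<Rightarrow> (nat \<Rightarrow> real) \<Rightarrow> nat \<Rightarrow> real" where
  "simplex_point d t =
     (\<lambda>i. if i = 0 then 1 - (\<Sum>j=1..d. t j) else if i \<le> d then t i else 0)"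

definition shift_coord :: "nat \<Rightarrow> (nat \<Rightarrow> real) \<Rightarrow> real \<Rightarrow> nat \<Rightarrow> real" where
  "shift_coord j x h = x(0 := x 0 - h, j := x j + h)"

definition open_simplex :: "nat \<Rightarrow> (nat \<Rightarrow> real) set" where
  "open_simplex d = {x \<in> standard_simplex d. \<forall>i\<le>d. 0 < x i}"

(* Continuously differentiable on the closed simplex: the partial derivatives on the open simplex
   extend continuously to the closed one. *)
definition C1_simplex :: "nat \<Rightarrow> ((nat \<Rightarrow> real) \<Rightarrow> complex ^ 'k::finite) \<Rightarrow> bool" where
  "C1_simplex d s \<longleftrightarrow>
     (\<forall>j\<in>{1..d}. \<exists>G. continuous_on (standard_simplex d) G \<and>
        (\<forall>x\<in>open_simplex d. ((\<lambda>h. s (shift_coord j x h)) has_vector_derivative G x) (at 0)))"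

definition simplex_partial :: "((nat \<Rightarrow> real) \<Rightarrow> complex ^ 'k::finite) \<Rightarrow> (nat \<Rightarrow> real) \<Rightarrow> nat \<Rightarrow> complex ^ 'k" where
  "simplex_partial s x j = vector_derivative (\<lambda>h. s (shift_coord j x h)) (at 0)"

(* The integral of the pullback s^* omega.  The domain is the open simplex, which differs from the
   closed one by a null set, because partial derivatives on the boundary are not controlled.
   For d = 0 this is the value of omega at the point s. *)
definition simplex_integral :: "nat \<Rightarrow> ((nat \<Rightarrow> real) \<Rightarrow> complex ^ 'k::finite) \<Rightarrow> 'k form \<Rightarrow> complex" where
  "simplex_integral d s \<omega> =
     (LINT t : {t \<in> {1..d} \<rightarrow>\<^sub>E UNIV. simplex_point d t \<in> open_simplex d} | (\<Pi>\<^sub>M i\<in>{1..d}. lborel).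
        \<omega> (s (simplex_point d t)) (map (simplex_partial s (simplex_point d t)) [1..<Suc d]))"

definition chain_integral :: "nat \<Rightarrow> (complex ^ 'k::finite) chain \<Rightarrow> 'k form \<Rightarrow> complex" where
  "chain_integral d \<sigma> \<omega> =
     (\<Sum>s\<in>Poly_Mapping.keys \<sigma>. of_int (Poly_Mapping.lookup \<sigma> s) * simplex_integral d s \<omega>)"

definition chain_support :: "nat \<Rightarrow> 'a chain \<Rightarrow> 'a set" where
  "chain_support d \<sigma> = (\<Union>s\<in>Poly_Mapping.keys \<sigma>. s ` standard_simplex d)"

definition relative_chain ::
    "nat \<Rightarrow> (complex ^ 'k::finite) set \<Rightarrow> (complex ^ 'k) set \<Rightarrow> (complex ^ 'k) chain \<Rightarrow> bool" where
  "relative_chain d X Y \<sigma> \<longleftrightarrow> singular_relcycle d (top_of_set X) Y \<sigma> \<and>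
     (\<forall>s\<in>Poly_Mapping.keys \<sigma>. C1_simplex d s)"


section \<open>Periods\<close>

(* Periods in the sense of Kontsevich and Zagier: the real and imaginary parts are absolutely
   convergent integrals of rational functions over Q on semialgebraic sets over Q. *)

definition mpolys_in :: "nat \<Rightarrow> (nat, rat) mpoly set" where
  "mpolys_in n = {p. \<forall>\<mu>\<in>Poly_Mapping.keys p. Poly_Mapping.keys \<mu> \<subseteq> {..<n}}"

definition semialgebraic :: "nat \<Rightarrow> (nat \<Rightarrow> real) set \<Rightarrow> bool" where
  "semialgebraic n S \<longleftrightarrow>
     (\<exists>\<F>. finite \<F> \<and>
        (\<forall>(P, Q)\<in>\<F>. finite P \<and> finite Q \<and> P \<subseteq> mpolys_in n \<and> Q \<subseteq> mpolys_in n) \<and>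
        S = (\<Union>(P, Q)\<in>\<F>. {x \<in> {..<n} \<rightarrow>\<^sub>E UNIV.
               (\<forall>p\<in>P. mpeval of_rat p x = 0) \<and> (\<forall>q\<in>Q. 0 < mpeval of_rat q x)}))"

definition real_period :: "real \<Rightarrow> bool" where
  "real_period r \<longleftrightarrow>
     (\<exists>n S p q. semialgebraic n S \<and> p \<in> mpolys_in n \<and> q \<in> mpolys_in n \<and>
        (\<forall>x\<in>S. mpeval of_rat q x \<noteq> (0::real)) \<and>
        set_integrable (\<Pi>\<^sub>M i\<in>{..<n}. lborel) S (\<lambda>x. mpeval of_rat p x / mpeval of_rat q x) \<and>
        r = (LINT x : S | (\<Pi>\<^sub>M i\<in>{..<n}. lborel). mpeval of_rat p x / mpeval of_rat q x))"

definition period :: "complex \<Rightarrow> bool" where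
  "period z \<longleftrightarrow> real_period (Re z) \<and> real_period (Im z)"


section \<open>Admissible modules of polynomials\<close>

(* X is reduced, so two regular functions agree iff they agree at all complex points. *)
definition f_admissible ::
    "(complex ^ 'k::finite) set \<Rightarrow> (complex ^ 'k \<Rightarrow> complex ^ 'r::finite) \<Rightarrow> ('r, int) mpoly set \<Rightarrow> bool" where
  "f_admissible X f \<N> \<longleftrightarrow> inj_on (\<lambda>\<mm>. restrict (\<lambda>y. int_eval \<mm> (f y)) X) \<N>"

(* Bases are indexed from 0: the basis elements are b 0, ..., b (N - 1). *)

definition int_basis_family :: "nat \<Rightarrow> (nat \<Rightarrow> 'a::comm_ring_1) \<Rightarrow> 'a set \<Rightarrow> bool" where
  "int_basis_family N b M \<longleftrightarrow> inj_on b {..<N} \<and> int_basis (b ` {..<N}) M"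

definition Q_matrix ::
    "nat \<Rightarrow> (complex ^ 'k::finite) chain \<Rightarrow> 'k form \<Rightarrow> (complex ^ 'k \<Rightarrow> complex ^ 'r::finite) \<Rightarrow>
     nat \<Rightarrow> (nat \<Rightarrow> ('r, int) mpoly) \<Rightarrow> complex mat" where
  "Q_matrix d \<sigma> \<omega> f N b =
     mat N N (\<lambda>(i, j). chain_integral d \<sigma>
       (fun_times_form (\<lambda>y. int_eval (b i) (f y) * int_eval (b j) (f y)) \<omega>))"

(* A supremum of real numbers: finite for bounded \<tau>, in particular for compact \<tau>, which is the only
   case in which it is meaningful. *)
definition t_sup :: "nat \<Rightarrow> (nat \<Rightarrow> ('r::finite, int) mpoly) \<Rightarrow> (complex ^ 'r) set \<Rightarrow> real" where
  "t_sup N b \<tau> =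
     (SUP z\<in>{z. \<forall>i<N. z i \<in> \<tau>}. cmod (Determinant.det (mat N N (\<lambda>(i, j). int_eval (b j) (z i)))))"

definition limsup_root :: "(nat \<Rightarrow> nat) \<Rightarrow> (nat \<Rightarrow> real) \<Rightarrow> ereal" where
  "limsup_root e a = limsup (\<lambda>n. ereal (a n powr (1 / real (e n))))"

definition Sup_N ::
    "(nat \<Rightarrow> nat) \<Rightarrow> (nat \<Rightarrow> nat) \<Rightarrow> (nat \<Rightarrow> nat \<Rightarrow> ('r::finite, int) mpoly) \<Rightarrow> (complex ^ 'r) set \<Rightarrow> ereal" where
  "Sup_N e N b \<tau> = limsup_root e (\<lambda>n. t_sup (N n) (b n) \<tau>)"

definition GL_rat :: "nat \<Rightarrow> rat mat set" where
  "GL_rat N = {A \<in> carrier_mat N N. invertible_mat A}"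

definition delta :: "rat mat \<Rightarrow> rat mat \<Rightarrow> real" where
  "delta A B = of_rat \<bar>Determinant.det A * Determinant.det B\<bar>"

end

theory Submission
  imports Defs
begin

text \<open>If the rational span had dimension at most 1, the integer span of the \<open>\<xi>\<^sub>i\<close> would lie in
  \<open>\<int> \<theta>\<close> for a single \<open>\<theta>\<close>, so \<open>det (D\<^sup>l Q D\<^sup>r)\<close> would be a non-zero integer multiple of \<open>\<theta>\<^sup>N\<close>,
  whence \<open>\<bar>\<theta>\<bar>\<^sup>N \<le> \<delta>\<^sub>N \<bar>det Q\<bar>\<close>.  On the other hand, Andreief's identity expresses \<open>N! det Q\<close> as the
  integral of \<open>det (m\<^sub>j (f z\<^sub>i))\<^sup>2\<close> over \<open>\<sigma>\<^sup>N\<close>, so that \<open>N! \<bar>det Q\<bar> \<le> C\<^sup>N t\<^sub>N\<^sup>2\<close>.  Together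
  \<open>1 \<le> \<delta>\<^sub>N t\<^sub>N\<^sup>2 (C / \<bar>\<theta>\<bar>)\<^sup>N / N!\<close>, and as the factorial beats the exponential, \<open>\<delta>\<^sub>N t\<^sub>N\<^sup>2 \<ge> 1\<close> for
  infinitely many \<open>n\<close>, against the assumption on the limits superior.\<close>

section \<open>Bounded linear functionals and Gram determinants\<close>

text \<open>Abstracts the map sending \<open>g\<close> to the integral of \<open>g\<close> times the
  form over the chain. The determinant estimate needs only linearity on \<open>A\<close> and control
  of \<open>L g\<close> by the size of \<open>g\<close> on \<open>K\<close>, so it can be proved
  without measure theory.\<close>

locale bounded_functional =
  fixes A :: "('a \<Rightarrow> complex) set" and L :: "('a \<Rightarrow> complex) \<Rightarrow> complex" and K :: "'a set" and C :: real
  assumes zero_mem: "(\<lambda>x. 0) \<in> A"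
    and lincomb_mem: "\<And>c g h. g \<in> A \<Longrightarrow> h \<in> A \<Longrightarrow> (\<lambda>x. c * g x + h x) \<in> A"
    and lincomb: "\<And>c g h. g \<in> A \<Longrightarrow> h \<in> A \<Longrightarrow> L (\<lambda>x. c * g x + h x) = c * L g + L h"
    and bound: "\<And>g B. g \<in> A \<Longrightarrow> 0 \<le> B \<Longrightarrow> (\<And>x. x \<in> K \<Longrightarrow> cmod (g x) \<le> B) \<Longrightarrow> cmod (L g) \<le> C * B"
    and nonneg: "0 \<le> C"
begin

lemma sum_mem_and_eq:
  assumes "finite I" "\<And>i. i \<in> I \<Longrightarrow> g i \<in> A"
  shows "(\<lambda>x. \<Sum>i\<in>I. c i * g i x) \<in> A \<and> L (\<lambda>x. \<Sum>i\<in>I. c i * g i x) = (\<Sum>i\<in>I. c i * L (g i))"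
  using assms
proof (induction I rule: finite_induct)
  case empty
  \<comment> \<open>The bound with \<open>B = 0\<close> gives that \<open>L\<close> vanishes at the
    zero function.\<close>
  have "cmod (L (\<lambda>x. 0)) \<le> C * 0"
    by (rule bound[OF zero_mem]) auto
  then show ?case by (simp add: zero_mem)
next
  case (insert i I)
  then show ?case
    using lincomb_mem[of "g i" "\<lambda>x. \<Sum>i\<in>I. c i * g i x" "c i"]
      lincomb[of "g i" "\<lambda>x. \<Sum>i\<in>I. c i * g i x" "c i"] by simp
qed

text \<open>The bound is applied in one variable at a time, which replaces integration over the product
  \<open>K\<^sup>N\<close> and Fubini's theorem.\<close>

lemma tensor_bound:
  assumes "finite I"
    and h: "\<And>i j. i \<in> I \<Longrightarrow> j < N \<Longrightarrow> h i j \<in> A"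
    and "0 \<le> B"
    and "\<And>z. (\<And>j. j < N \<Longrightarrow> z j \<in> K) \<Longrightarrow> cmod (\<Sum>i\<in>I. c i * (\<Prod>j<N. h i j (z j))) \<le> B"
  shows "cmod (\<Sum>i\<in>I. c i * (\<Prod>j<N. L (h i j))) \<le> C ^ N * B"
  using assms(2-)
proof (induction N arbitrary: c B)
  case 0
  then show ?case by simp
next
  case (Suc N)
  \<comment> \<open>The last variable is integrated first: \<open>L (h i N)\<close> is absorbed into
    the coefficients, and the uniform bound becomes \<open>C * B\<close>.\<close>
  have "cmod (\<Sum>i\<in>I. (c i * L (h i N)) * (\<Prod>j<N. L (h i j))) \<le> C ^ N * (C * B)"
  proof (rule Suc.IH)
    fix z :: "nat \<Rightarrow> 'a" assume z: "\<And>j. j < N \<Longrightarrow> z j \<in> K"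
    \<comment> \<open>With the first \<open>N\<close> variables frozen at \<open>z\<close>, the sum
      is a linear combination of functions of the last variable alone.\<close>
    let ?c = "\<lambda>i. c i * (\<Prod>j<N. h i j (z j))"
    have "cmod (L (\<lambda>x. \<Sum>i\<in>I. ?c i * h i N x)) \<le> C * B"
    proof (rule bound)
      show "(\<lambda>x. \<Sum>i\<in>I. ?c i * h i N x) \<in> A"
        using sum_mem_and_eq[OF \<open>finite I\<close>, of "\<lambda>i. h i N" ?c] Suc.prems(1) by simp
      fix x assume "x \<in> K"
      then have "cmod (\<Sum>i\<in>I. c i * (\<Prod>j<Suc N. h i j ((z(N := x)) j))) \<le> B"
        using z by (intro Suc.prems(3)) (auto simp: less_Suc_eq)
      then show "cmod (\<Sum>i\<in>I. ?c i * h i N x) \<le> B"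
        by (simp add: mult.assoc)
    qed (fact \<open>0 \<le> B\<close>)
    moreover have "L (\<lambda>x. \<Sum>i\<in>I. ?c i * h i N x) = (\<Sum>i\<in>I. ?c i * L (h i N))"
      using sum_mem_and_eq[OF \<open>finite I\<close>, of "\<lambda>i. h i N" ?c] Suc.prems(1) by simp
    ultimately show "cmod (\<Sum>i\<in>I. (c i * L (h i N)) * (\<Prod>j<N. h i j (z j))) \<le> C * B"
      by (simp add: mult_ac)
  qed (use Suc.prems nonneg in auto)
  then show ?case by (simp add: mult_ac)
qed

text \<open>Andreief's identity: expand both determinants over permutations.\<close>

lemma gram_det_bound:
  assumes g: "\<And>i j. i < N \<Longrightarrow> j < N \<Longrightarrow> (\<lambda>x. g i x * g j x) \<in> A"
    and T: "\<And>z. (\<And>j. j < N \<Longrightarrow> z j \<in> K) \<Longrightarrow> cmod (Determinant.det (mat N N (\<lambda>(i, j). g j (z i)))) \<le> T"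
  shows "fact N * cmod (Determinant.det (mat N N (\<lambda>(i, j). L (\<lambda>x. g i x * g j x)))) \<le> C ^ N * T\<^sup>2"
proof -
  \<comment> \<open>The square of the determinant is a sum of product functions indexed by pairs of
    permutations: \<open>c\<close> holds the signs and \<open>h\<close> the factor in the variable
    \<open>j\<close>.\<close>
  define P where "P = {p. p permutes {0..<N}}"
  define c :: "(nat \<Rightarrow> nat) \<times> (nat \<Rightarrow> nat) \<Rightarrow> complex" where "c = (\<lambda>(p, q). signof p * signof q)"
  define h where "h = (\<lambda>(p :: nat \<Rightarrow> nat, q :: nat \<Rightarrow> nat) j x. g (p j) x * g (q j) x)"
  have fin: "finite P" unfolding P_def by (simp add: finite_permutations)
  have lt: "p j < N" if "p \<in> P" "j < N" for p j
    using that permutes_in_image[of p "{0..<N}" j] unfolding P_def by auto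
  have sq: "(\<Sum>i\<in>P \<times> P. c i * (\<Prod>j<N. h i j (z j))) = (Determinant.det (mat N N (\<lambda>(i, j). g j (z i))))\<^sup>2" for z
  proof -
    have "Determinant.det (mat N N (\<lambda>(i, j). g j (z i))) = (\<Sum>p\<in>P. signof p * (\<Prod>i<N. g (p i) (z i)))"
      unfolding det_def P_def
      by (auto intro!: sum.cong prod.cong simp: atLeast0LessThan permutes_in_image)
    then show ?thesis
      by (simp add: power2_eq_square sum_product sum.cartesian_product c_def h_def prod.distrib
          mult_ac case_prod_unfold)
  qed
  have "cmod (\<Sum>i\<in>P \<times> P. c i * (\<Prod>j<N. L (h i j))) \<le> C ^ N * T\<^sup>2"
  proof (rule tensor_bound)
    fix z :: "nat \<Rightarrow> 'a" assume "\<And>j. j < N \<Longrightarrow> z j \<in> K"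
    then show "cmod (\<Sum>i\<in>P \<times> P. c i * (\<Prod>j<N. h i j (z j))) \<le> T\<^sup>2"
      unfolding sq norm_power by (intro power_mono T) auto
  qed (use fin g lt in \<open>auto simp: h_def\<close>)
  also have "(\<Sum>i\<in>P \<times> P. c i * (\<Prod>j<N. L (h i j)))
      = fact N * Determinant.det (mat N N (\<lambda>(i, j). L (\<lambda>x. g i x * g j x)))" (is "_ = _ * ?D")
  proof -
    \<comment> \<open>Replacing \<open>q\<close> by \<open>q \<circ> p\<close> cancels the sign of
      \<open>p\<close>, and reindexing the product by \<open>p\<close> removes \<open>p\<close> from
      it. Hence each \<open>p\<close> contributes the same determinant, which gives the factor
      \<open>fact N\<close>.\<close>
    have "(\<Sum>q\<in>P. signof p * signof q * (\<Prod>j<N. L (\<lambda>x. g (p j) x * g (q j) x))) = ?D" if p: "p \<in> P" for p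
    proof -
      have pp: "p permutes {0..<N}" using p by (simp add: P_def)
      have "(\<Sum>q\<in>P. signof p * signof q * (\<Prod>j<N. L (\<lambda>x. g (p j) x * g (q j) x)))
        = (\<Sum>q\<in>P. signof p * signof (q \<circ> p) * (\<Prod>j<N. L (\<lambda>x. g (p j) x * g ((q \<circ> p) j) x)))"
        unfolding P_def by (rule sum_permutations_compose_right[OF pp])
      also have "\<dots> = (\<Sum>q\<in>P. signof q * (\<Prod>j<N. L (\<lambda>x. g j x * g (q j) x)))"
      proof (rule sum.cong[OF refl])
        fix q assume "q \<in> P"
        then have q: "q permutes {0..<N}" by (simp add: P_def)
        have "(signof (q \<circ> p) :: complex) = signof q * signof p"
          by (rule signof_compose[OF q pp])
        then have "signof p * (signof (q \<circ> p) :: complex) = signof q"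
          by (simp add: sign_def)
        moreover have "(\<Prod>j<N. L (\<lambda>x. g j x * g (q j) x)) = (\<Prod>j<N. L (\<lambda>x. g (p j) x * g ((q \<circ> p) j) x))"
          using prod.permute[OF pp, of "\<lambda>j. L (\<lambda>x. g j x * g (q j) x)"]
          by (simp add: atLeast0LessThan comp_def)
        ultimately show "signof p * signof (q \<circ> p) * (\<Prod>j<N. L (\<lambda>x. g (p j) x * g ((q \<circ> p) j) x))
          = signof q * (\<Prod>j<N. L (\<lambda>x. g j x * g (q j) x))" by simp
      qed
      also have "\<dots> = ?D"
        unfolding det_def P_def
        by (auto intro!: sum.cong prod.cong simp: atLeast0LessThan permutes_in_image)
      finally show ?thesis .
    qed
    then have "(\<Sum>i\<in>P \<times> P. c i * (\<Prod>j<N. L (h i j))) = of_nat (card P) * ?D"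
      by (simp add: sum.cartesian_product' c_def h_def)
    moreover have "card P = fact N"
      unfolding P_def by (simp add: card_permutations)
    ultimately show ?thesis by simp
  qed
  finally show ?thesis by (simp add: norm_mult)
qed

end

section \<open>Products of limits superior of roots\<close>

text \<open>The strict inequality survives when both limits are enlarged by a small
  \<open>t\<close>. For large \<open>n\<close> the roots lie below the enlarged limits, whereas a
  product that is at least 1 would have a root that is at least 1.\<close>

lemma limsup_root_product_less_one:
  fixes a b :: "nat \<Rightarrow> real" and e :: "nat \<Rightarrow> nat"
  assumes fin: "\<bar>limsup_root e a\<bar> \<noteq> \<infinity>" "\<bar>limsup_root e b\<bar> \<noteq> \<infinity>"
    and less: "(limsup_root e a)\<^sup>2 * limsup_root e b < 1"
    and e: "eventually (\<lambda>n. 0 < e n) sequentially"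
  shows "eventually (\<lambda>n. \<not> (0 < a n \<and> 0 < b n \<and> 1 \<le> (a n)\<^sup>2 * b n)) sequentially"
proof -
  obtain x where x: "limsup_root e a = ereal x" using fin(1) by auto
  obtain y where y: "limsup_root e b = ereal y" using fin(2) by auto
  have "0 \<le> limsup_root e a" "0 \<le> limsup_root e b"
    unfolding limsup_root_def by (auto intro!: le_Limsup)
  then have "0 \<le> x" "0 \<le> y" using x y by auto
  have xy: "x\<^sup>2 * y < 1"
    using less unfolding x y by (simp add: power2_eq_square one_ereal_def)
  \<comment> \<open>Continuity at 0 from the right provides the common enlargement
    \<open>t\<close>.\<close>
  have "tendsto (\<lambda>t. (x + t)\<^sup>2 * (y + t)) ((x + 0)\<^sup>2 * (y + 0)) (at_right 0)"
    by (intro tendsto_intros)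
  then have "eventually (\<lambda>t. (x + t)\<^sup>2 * (y + t) < 1) (at_right 0)"
    using xy order_tendstoD(2) by fastforce
  then obtain t where t: "0 < t" "(x + t)\<^sup>2 * (y + t) < 1"
    using eventually_happens'[OF trivial_limit_at_right_real eventually_conj[OF eventually_at_right_less]]
    by blast
  have "eventually (\<lambda>n. ereal (a n powr (1 / real (e n))) < ereal (x + t)) sequentially"
    using x t(1) unfolding limsup_root_def by (intro Limsup_lessD) auto
  moreover have "eventually (\<lambda>n. ereal (b n powr (1 / real (e n))) < ereal (y + t)) sequentially"
    using y t(1) unfolding limsup_root_def by (intro Limsup_lessD) auto
  ultimately show ?thesis using e
  proof eventually_elim
    case (elim n)
    show ?case
    proof
      assume *: "0 < a n \<and> 0 < b n \<and> 1 \<le> (a n)\<^sup>2 * b n"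
      have "1 \<le> ((a n)\<^sup>2 * b n) powr (1 / real (e n))"
        using * by (intro ge_one_powr_ge_zero) auto
      also have "\<dots> = (a n powr (1 / real (e n)))\<^sup>2 * b n powr (1 / real (e n))"
        using * by (simp add: powr_mult power2_eq_square)
      also have "\<dots> \<le> (x + t)\<^sup>2 * (y + t)"
        using elim \<open>0 \<le> x\<close> \<open>0 \<le> y\<close> t(1) by (intro mult_mono power_mono) auto
      finally show False using t(2) by simp
    qed
  qed
qed

section \<open>Rational rank one and integrality of determinants\<close>

interpretation rat_vs: Vector_Spaces.vector_space rat_scale
  by (rule vector_space_rat_scale)

lemma rat_span_singleton: "rat_span {\<eta>} = {of_rat q * \<eta> | q. True}"
  by (auto simp: rat_vs.span_singleton)

text \<open>A basis chosen inside \<open>S\<close> has at most one element. That element serves as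
  \<open>\<eta>\<close>; if the basis is empty, any \<open>\<eta>\<close> will do.\<close>

lemma rat_dim_less_2_imp_rank_le_1:
  assumes "finite S" "rat_dim (rat_span S) < 2"
  shows "\<exists>\<eta>. \<forall>x\<in>S. \<exists>q. x = of_rat q * \<eta>"
proof -
  obtain B where B: "B \<subseteq> S" "\<not> rat_vs.dependent B" "S \<subseteq> rat_span B" "card B = rat_dim S"
    using rat_vs.basis_exists[of S] by metis
  have "card B \<le> 1" using B(4) assms(2) by simp
  moreover have "finite B" using B(1) assms(1) finite_subset by blast
  ultimately obtain \<eta> where "B \<subseteq> {\<eta>}"
    by (metis card_le_Suc0_iff_eq One_nat_def subsetI insert_iff)
  then have "S \<subseteq> rat_span {\<eta>}"
    using B(3) rat_vs.span_mono by blast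
  then show ?thesis unfolding rat_span_singleton by blast
qed

text \<open>Clearing denominators: \<open>\<theta>\<close> is \<open>\<eta>\<close> divided by a
  common denominator of the finitely many rational factors.\<close>

lemma int_span_of_rational_multiples:
  fixes S :: "complex set"
  assumes "finite S" "\<forall>x\<in>S. \<exists>q. x = of_rat q * \<eta>"
  shows "\<exists>\<theta>. \<forall>x\<in>int_span S. \<exists>k. x = of_int k * \<theta>"
proof -
  have "\<exists>D::int. 0 < D \<and> (\<forall>x\<in>S. \<exists>k. x = of_int k * (\<eta> / of_int D))"
    using assms
  proof (induction S rule: finite_induct)
    case empty
    show ?case by (intro exI[of _ 1]) auto
  next
    case (insert x S)
    obtain D :: int where D: "0 < D" "\<forall>x\<in>S. \<exists>k. x = of_int k * (\<eta> / of_int D)"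
      using insert by auto
    obtain q where q: "x = of_rat q * \<eta>" using insert.prems by auto
    obtain u v where uv: "quotient_of q = (u, v)" by fastforce
    have v: "0 < v" "q = of_int u / of_int v"
      using quotient_of_denom_pos[OF uv] quotient_of_div[OF uv] by auto
    \<comment> \<open>The new common denominator is the old one times the denominator
      \<open>v\<close> of the new factor.\<close>
    have "x = of_int (u * D) * (\<eta> / of_int (D * v))"
      using v D(1) q by (simp add: of_rat_divide)
    moreover have "\<exists>k. y = of_int k * (\<eta> / of_int (D * v))" if y: "y \<in> S" for y
    proof -
      obtain k where "y = of_int k * (\<eta> / of_int D)" using D(2) y by blast
      then have "y = of_int (k * v) * (\<eta> / of_int (D * v))" using v(1) D(1) by simp
      then show ?thesis by blast
    qed
    ultimately show ?case
      using v(1) D(1) by (intro exI[of _ "D * v"] conjI) (simp, blast)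
  qed
  then obtain D :: int where D: "\<forall>x\<in>S. \<exists>k. x = of_int k * (\<eta> / of_int D)" by blast
  interpret M: Modules.module "int_scale :: int \<Rightarrow> complex \<Rightarrow> complex" by (rule module_int_scale)
  have "M.subspace {of_int k * (\<eta> / of_int D) | k. True}"
  proof (rule M.subspaceI)
    show "0 \<in> {of_int k * (\<eta> / of_int D) | k. True}" by (auto intro: exI[of _ 0])
    fix x y assume "x \<in> {of_int k * (\<eta> / of_int D) | k. True}" "y \<in> {of_int k * (\<eta> / of_int D) | k. True}"
    then obtain k l where "x = of_int k * (\<eta> / of_int D)" "y = of_int l * (\<eta> / of_int D)" by blast
    then have "x + y = of_int (k + l) * (\<eta> / of_int D)" by (simp add: algebra_simps)
    then show "x + y \<in> {of_int k * (\<eta> / of_int D) | k. True}" by blast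
  next
    fix c x assume "x \<in> {of_int k * (\<eta> / of_int D) | k. True}"
    then obtain k where "x = of_int k * (\<eta> / of_int D)" by blast
    then have "of_int c * x = of_int (c * k) * (\<eta> / of_int D)" by simp
    then show "of_int c * x \<in> {of_int k * (\<eta> / of_int D) | k. True}" by blast
  qed
  then have "int_span S \<subseteq> {of_int k * (\<eta> / of_int D) | k. True}"
    by (intro M.span_minimal) (use D in auto)
  then show ?thesis by blast
qed

text \<open>One factor \<open>\<theta>\<close> comes out of each of the \<open>N\<close> rows,
  leaving the determinant of an integer matrix.\<close>

lemma det_int_multiples:
  fixes A :: "complex mat"
  assumes A: "A \<in> carrier_mat N N" and mult: "\<And>i j. i < N \<Longrightarrow> j < N \<Longrightarrow> \<exists>k. A $$ (i, j) = of_int k * \<theta>"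
  shows "\<exists>k. Determinant.det A = of_int k * \<theta> ^ N"
proof -
  obtain k where k: "\<And>i j. i < N \<Longrightarrow> j < N \<Longrightarrow> A $$ (i, j) = of_int (k i j) * \<theta>"
    using mult by metis
  define M where "M = mat N N (\<lambda>(i, j). k i j)"
  have "A = \<theta> \<cdot>\<^sub>m map_mat of_int M"
    by (rule eq_matI) (use A k in \<open>auto simp: M_def\<close>)
  then have "Determinant.det A = of_int (Determinant.det M) * \<theta> ^ N"
    by (simp add: of_int_hom.hom_det M_def)
  then show ?thesis by blast
qed

lemma GL_rat_det_nonzero:
  assumes "A \<in> GL_rat N"
  shows "Determinant.det A \<noteq> 0"
proof -
  have A: "A \<in> carrier_mat N N" using assms by (simp add: GL_rat_def)
  obtain B where AB: "A * B = 1\<^sub>m N" and BA: "B * A = 1\<^sub>m (dim_row B)"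
    using assms by (auto simp: GL_rat_def invertible_mat_def inverts_mat_def)
  \<comment> \<open>Invertibility supplies \<open>B\<close> without its size; counting columns in
    the two identities recovers it.\<close>
  have "dim_col B = N" "dim_row B = N"
    using arg_cong[OF AB, of dim_col] arg_cong[OF BA, of dim_col] A by auto
  then have "Determinant.det A * Determinant.det B = 1"
    using det_mult[OF A, of B] AB by auto
  then show ?thesis by auto
qed

section \<open>Analytic properties of polynomial evaluation\<close>

lemma continuous_on_mpeval [continuous_intros]:
  fixes y :: "'a::topological_space \<Rightarrow> 'i \<Rightarrow> 'b::real_normed_field"
  assumes "\<And>i. continuous_on S (\<lambda>x. y x i)"
  shows "continuous_on S (\<lambda>x. mpeval c p (y x))"
  unfolding mpeval_def using assms by (intro continuous_intros) auto

lemma holomorphic_on_mpeval [holomorphic_intros]: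
  assumes "\<And>i. (\<lambda>x. y x i) holomorphic_on S"
  shows "(\<lambda>x. mpeval c p (y x)) holomorphic_on S"
  unfolding mpeval_def using assms by (intro holomorphic_intros) auto

lemma differentiable_mpeval:
  fixes y :: "'a::real_normed_vector \<Rightarrow> 'i \<Rightarrow> 'b::real_normed_field"
  assumes "\<And>i. (\<lambda>x. y x i) differentiable (at x)"
  shows "(\<lambda>x. mpeval c p (y x)) differentiable (at x)"
proof -
  have "(\<lambda>x. \<Prod>i\<in>I. y x i ^ n i) differentiable (at x)" if "finite I" for I and n :: "'i \<Rightarrow> nat"
    using that by (induction I rule: finite_induct) (auto simp: assms)
  then have "(\<lambda>x. c (Poly_Mapping.lookup p \<mu>) *
      (\<Prod>i\<in>Poly_Mapping.keys \<mu>. y x i ^ Poly_Mapping.lookup \<mu> i)) differentiable (at x)" for \<mu>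
    by (rule differentiable_mult[OF differentiable_const]) simp
  then show ?thesis
    unfolding mpeval_def by (intro differentiable_sum) auto
qed

section \<open>The standard simplex and tangent vectors\<close>

lemma compact_standard_simplex: "compact (standard_simplex d)"
  using compactin_standard_simplex[of d] by (simp add: euclidean_product_topology)

lemma closed_standard_simplex: "closed (standard_simplex d)"
  by (rule compact_imp_closed[OF compact_standard_simplex])

lemma singular_simplex_top_of_set:
  "singular_simplex d (top_of_set X) s \<Longrightarrow>
    continuous_on (standard_simplex d) s \<and> s ` standard_simplex d \<subseteq> X"
  by (auto simp: singular_simplex_def euclidean_product_topology continuous_map_in_subtopology
      image_subset_iff_funcset Pi_iff)

text \<open>Moving the weight \<open>h\<close> from vertex 0 to vertex \<open>j\<close> preserves
  the sum of the coordinates, and the bound on \<open>h\<close> keeps both changed coordinates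
  nonnegative. Thus the curves that define partial derivatives stay in the simplex near 0.\<close>

lemma shift_coord_in_standard_simplex:
  assumes x: "x \<in> open_simplex d" and j: "j \<in> {1..d}" and h: "\<bar>h\<bar> < min (x 0) (x j)"
  shows "shift_coord j x h \<in> standard_simplex d"
proof -
  have x0: "x \<in> standard_simplex d" using x by (simp add: open_simplex_def)
  have eq: "shift_coord j x h = (\<lambda>i. x i + (if i = j then h else 0) - (if i = 0 then h else 0))"
    using j by (auto simp: shift_coord_def)
  have "(\<Sum>i\<le>d. shift_coord j x h i) = 1"
    unfolding eq using j x0 by (simp add: sum.distrib sum_subtractf standard_simplex_def)
  moreover have nonneg: "0 \<le> shift_coord j x h i" for i
    using x0 h by (auto simp: shift_coord_def standard_simplex_def)
  moreover have "shift_coord j x h i = 0" if "i > d" for i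
    using that j x0 by (auto simp: shift_coord_def standard_simplex_def)
  moreover have "shift_coord j x h i \<le> 1" for i
  proof (cases "i \<le> d")
    case True
    then show ?thesis
      using member_le_sum[of i "{..d}" "shift_coord j x h"] nonneg calculation(1) by auto
  qed (use calculation(3) in auto)
  ultimately show ?thesis by (auto simp: standard_simplex_def)
qed

text \<open>A regular form is prescribed only on tangent vectors of \<open>X\<close>, so this is needed for its pullback to
  be continuous.\<close>

lemma simplex_derivative_in_tangent_space:
  fixes X :: "(complex ^ 'k::finite) set"
  assumes s: "s ` standard_simplex d \<subseteq> X"
    and x: "x \<in> open_simplex d" and j: "j \<in> {1..d}"
    and v: "((\<lambda>h. s (shift_coord j x h)) has_vector_derivative v) (at 0)"
  shows "v \<in> tangent_space X (s x)"
  unfolding tangent_space_def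
proof safe
  fix p assume p: "p \<in> vanishing_ideal X"
  have [simp]: "shift_coord j x 0 = x" by (auto simp: shift_coord_def)
  have "(rat_eval p) differentiable (at (s x))"
    by (intro differentiable_mpeval bounded_linear_imp_differentiable bounded_linear_vec_nth)
  then obtain D where D: "(rat_eval p has_derivative D) (at (s x))"
    unfolding differentiable_def by blast
  have "((\<lambda>h. rat_eval p (s (shift_coord j x h))) has_vector_derivative D v) (at 0)"
    using vector_derivative_diff_chain_within[OF v, of "rat_eval p" D] D
    by (simp add: comp_def has_derivative_at_withinI)
  \<comment> \<open>Near \<open>h = 0\<close> the curve runs inside \<open>X\<close>, where
    \<open>p\<close> is identically zero.\<close>
  moreover have "((\<lambda>h. rat_eval p (s (shift_coord j x h))) has_vector_derivative 0) (at 0)"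
  proof (rule has_vector_derivative_transform_within_open)
    let ?e = "min (x 0) (x j)"
    show "((\<lambda>h. 0 :: complex) has_vector_derivative 0) (at (0::real))" by simp
    show "open {-?e<..<?e}" by simp
    show "0 \<in> {-?e<..<?e}" using x j by (auto simp: open_simplex_def)
    fix h assume "h \<in> {-?e<..<?e}"
    then have "\<bar>h\<bar> < ?e" by auto
    then have "s (shift_coord j x h) \<in> X"
      using s shift_coord_in_standard_simplex[OF x j] by blast
    then show "0 = rat_eval p (s (shift_coord j x h))"
      using p by (simp add: vanishing_ideal_def)
  qed
  ultimately have Dv: "D v = 0" by (metis vector_derivative_unique_at)
  \<comment> \<open>\<open>tangent_space\<close> uses a complex derivative along a line, while
    \<open>D\<close> is a real derivative. Restricting the line to real parameters makes the two
    comparable.\<close>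
  have "(\<lambda>t. rat_eval p (s x + t *s v)) field_differentiable (at 0)"
  proof (rule holomorphic_on_imp_differentiable_at)
    show "(\<lambda>t. rat_eval p (s x + t *s v)) holomorphic_on UNIV"
      unfolding vector_add_component vector_smult_component by (intro holomorphic_intros)
  qed auto
  then have "((\<lambda>t. rat_eval p (s x + t *s v)) has_field_derivative
      deriv (\<lambda>t. rat_eval p (s x + t *s v)) 0) (at (complex_of_real 0))"
    by (simp add: field_differentiable_derivI)
  from has_vector_derivative_real_field[OF this]
  have "((\<lambda>h. rat_eval p (s x + complex_of_real h *s v)) has_vector_derivative
      deriv (\<lambda>t. rat_eval p (s x + t *s v)) 0) (at 0)" .
  moreover have "((\<lambda>h. rat_eval p (s x + complex_of_real h *s v)) has_vector_derivative D v) (at 0)"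
  proof -
    have eq: "s x + complex_of_real h *s v = s x + h *\<^sub>R v" for h
      by (simp add: Finite_Cartesian_Product.vec_eq_iff scaleR_conv_of_real[where 'a = complex])
    have "((\<lambda>h. s x + h *\<^sub>R v) has_vector_derivative v) (at 0)"
      by (auto intro!: derivative_eq_intros)
    from vector_derivative_diff_chain_within[OF this, of "rat_eval p" D] show ?thesis
      using D by (simp add: comp_def has_derivative_at_withinI eq)
  qed
  ultimately show "deriv (\<lambda>t. rat_eval p (s x + t *s v)) 0 = 0"
    using Dv by (metis vector_derivative_unique_at)
qed

section \<open>Measurability and integrability on the simplex\<close>

lemma simplex_point_measurable [measurable]:
  "simplex_point d \<in> borel_measurable (\<Pi>\<^sub>M i\<in>{1..d}. lborel)"
proof (rule measurable_coordinatewise_then_product)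
  fix i
  show "(\<lambda>t. simplex_point d t i) \<in> borel_measurable (\<Pi>\<^sub>M i\<in>{1..d}. lborel)"
    unfolding simplex_point_def by (cases "i = 0"; cases "i \<le> d") auto
qed

lemma open_simplex_borel [measurable]: "open_simplex d \<in> sets borel"
proof -
  have "open_simplex d = standard_simplex d \<inter> (\<Inter>i\<in>{..d}. {x. 0 < x i})"
    by (auto simp: open_simplex_def)
  moreover have "open (\<Inter>i\<in>{..d}. {x :: nat \<Rightarrow> real. 0 < x i})"
    by (intro open_INT ballI open_Collect_less continuous_intros) auto
  ultimately show ?thesis
    by (simp add: sets.Int borel_closed closed_standard_simplex borel_open)
qed

abbreviation simplex_domain :: "nat \<Rightarrow> (nat \<Rightarrow> real) set" where
  "simplex_domain d \<equiv> {t \<in> {1..d} \<rightarrow>\<^sub>E UNIV. simplex_point d t \<in> open_simplex d}"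

lemma simplex_domain_measurable: "simplex_domain d \<in> sets (\<Pi>\<^sub>M i\<in>{1..d}. lborel)"
proof -
  have "simplex_domain d = simplex_point d -` open_simplex d \<inter> space (\<Pi>\<^sub>M i\<in>{1..d}. lborel)"
    by (auto simp: space_PiM)
  then show ?thesis by (metis measurable_sets[OF simplex_point_measurable open_simplex_borel])
qed

lemma emeasure_simplex_domain_finite: "emeasure (\<Pi>\<^sub>M i\<in>{1..d}. lborel) (simplex_domain d) < \<infinity>"
proof -
  interpret product_sigma_finite "\<lambda>_ :: nat. lborel :: real measure" by standard
  have "simplex_domain d \<subseteq> (\<Pi>\<^sub>E i\<in>{1..d}. {0..1})"
  proof
    fix t assume t: "t \<in> simplex_domain d"
    have "t i \<in> {0..1}" if "i \<in> {1..d}" for i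
    proof -
      have "simplex_point d t i = t i" using that by (auto simp: simplex_point_def)
      then show ?thesis using t by (metis (mono_tags, lifting) atLeastAtMost_iff mem_Collect_eq open_simplex_def standard_simplex_def)
    qed
    then show "t \<in> (\<Pi>\<^sub>E i\<in>{1..d}. {0..1})" using t by auto
  qed
  then have "emeasure (\<Pi>\<^sub>M i\<in>{1..d}. lborel) (simplex_domain d)
      \<le> emeasure (\<Pi>\<^sub>M i\<in>{1..d}. lborel) (\<Pi>\<^sub>E i\<in>{1..d}. {0..1 :: real})"
    by (intro emeasure_mono sets_PiM_I_finite) auto
  also have "\<dots> = 1"
    by (subst emeasure_PiM) auto
  finally show ?thesis
    by (rule le_less_trans) simp
qed

text \<open>By compactness \<open>h\<close> is bounded, and the domain of integration has finite
  measure since it lies in the unit cube.\<close>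

lemma continuous_set_integrable_simplex:
  fixes h :: "(nat \<Rightarrow> real) \<Rightarrow> complex"
  assumes "continuous_on (standard_simplex d) h"
  shows "set_integrable (\<Pi>\<^sub>M i\<in>{1..d}. lborel) (simplex_domain d) (\<lambda>t. h (simplex_point d t))"
proof -
  let ?M = "\<Pi>\<^sub>M i\<in>{1..d}. lborel"
  \<comment> \<open>Extension by zero yields a Borel function on the whole space; \<open>h\<close>
    is controlled only on the closed simplex.\<close>
  let ?h = "\<lambda>x. indicator (standard_simplex d) x *\<^sub>R h x"
  obtain B where B: "\<And>x. x \<in> standard_simplex d \<Longrightarrow> norm (h x) \<le> B"
    using compact_imp_bounded[OF compact_continuous_image[OF assms compact_standard_simplex]]
    unfolding bounded_iff by auto
  have "?h \<in> borel_measurable borel"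
    using assms
    by (intro borel_measurable_continuous_on_indicator borel_closed closed_standard_simplex)
  then have "(\<lambda>t. ?h (simplex_point d t)) \<in> borel_measurable ?M"
    by (rule measurable_compose[OF simplex_point_measurable])
  then have "integrable ?M (\<lambda>t. indicator (simplex_domain d) t *\<^sub>R ?h (simplex_point d t))"
    using B
    by (intro integrableI_bounded_set_indicator[where B = B] simplex_domain_measurable
        emeasure_simplex_domain_finite) (auto simp: open_simplex_def)
  then show ?thesis
    unfolding set_integrable_def
    by (rule Bochner_Integration.integrable_cong[THEN iffD1, rotated 2])
      (auto simp: indicator_def open_simplex_def)
qed

section \<open>Integrals over simplices and chains as bounded functionals\<close>

text \<open>\<open>H\<close> is the density of the pullback of the form. It is built from the
  continuous extensions of the partial derivatives, hence is continuous up to the boundary, and it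
  does not depend on \<open>g\<close>.\<close>

lemma simplex_integral_regular_form:
  fixes X :: "(complex ^ 'k::finite) set"
  assumes \<omega>: "regular_form d X \<omega>" and s: "singular_simplex d (top_of_set X) s" "C1_simplex d s"
  obtains H where "continuous_on (standard_simplex d) H"
    "\<And>g. simplex_integral d s (fun_times_form g \<omega>) =
       (LINT t : simplex_domain d | (\<Pi>\<^sub>M i\<in>{1..d}. lborel). g (s (simplex_point d t)) * H (simplex_point d t))"
proof -
  obtain a where a: "\<And>y vs. y \<in> X \<Longrightarrow> length vs = d \<Longrightarrow> set vs \<subseteq> tangent_space X y \<Longrightarrow>
          \<omega> y vs = (\<Sum>J | length J = d.
             rat_eval (a J) y * Determinant.det (mat d d (\<lambda>(i, j). vec_nth (vs ! i) (J ! j))))"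
    using \<omega> unfolding regular_form_def by blast
  obtain G where G: "\<And>j. j \<in> {1..d} \<Longrightarrow> continuous_on (standard_simplex d) (G j)"
    "\<And>j x. j \<in> {1..d} \<Longrightarrow> x \<in> open_simplex d \<Longrightarrow>
       ((\<lambda>h. s (shift_coord j x h)) has_vector_derivative G j x) (at 0)"
    using s(2) unfolding C1_simplex_def by metis
  have s_cont: "continuous_on (standard_simplex d) s" and s_X: "s ` standard_simplex d \<subseteq> X"
    using singular_simplex_top_of_set[OF s(1)] by auto
  \<comment> \<open>The shift in \<open>G (Suc i)\<close> matches matrix rows, counted from 0, with
    coordinate directions, counted from 1.\<close>
  define H where "H x = (\<Sum>J | length J = d. rat_eval (a J) (s x) *
      Determinant.det (mat d d (\<lambda>(i, j). vec_nth (G (Suc i) x) (J ! j))))" for x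
  have "continuous_on (standard_simplex d) (\<lambda>x.
      Determinant.det (mat d d (\<lambda>(i, j). vec_nth (G (Suc i) x) (J ! j))))" for J
    unfolding det_def
    by (auto intro!: continuous_intros G simp: permutes_in_image)
  then have "continuous_on (standard_simplex d) H"
    unfolding H_def by (intro continuous_intros s_cont)
  moreover have "simplex_integral d s (fun_times_form g \<omega>) =
       (LINT t : simplex_domain d | (\<Pi>\<^sub>M i\<in>{1..d}. lborel). g (s (simplex_point d t)) * H (simplex_point d t))" for g
  proof -
    have "fun_times_form g \<omega> (s x) (map (simplex_partial s x) [1..<Suc d]) = g (s x) * H x"
      if x: "x \<in> open_simplex d" for x
    proof -
      have part: "simplex_partial s x j = G j x" if "j \<in> {1..d}" for j
        unfolding simplex_partial_def using G(2)[OF that x] by (rule vector_derivative_at)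
      have "s x \<in> X" using x s_X by (auto simp: open_simplex_def)
      \<comment> \<open>Tangency is what permits the polynomial formula for \<open>\<omega>\<close>
        to be applied to these vectors.\<close>
      moreover have "set (map (simplex_partial s x) [1..<Suc d]) \<subseteq> tangent_space X (s x)"
        using simplex_derivative_in_tangent_space[OF s_X x _ G(2)[OF _ x]] part by auto
      ultimately have "\<omega> (s x) (map (simplex_partial s x) [1..<Suc d]) =
        (\<Sum>J | length J = d. rat_eval (a J) (s x) * Determinant.det (mat d d
           (\<lambda>(i, j). vec_nth (map (simplex_partial s x) [1..<Suc d] ! i) (J ! j))))"
        by (intro a) auto
      also have "\<dots> = H x"
        unfolding H_def
        by (intro sum.cong refl arg_cong2[where f = "(*)"] arg_cong[where f = Determinant.det] eq_matI)
          (auto simp: part simp del: upt_Suc)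
      finally show ?thesis by (simp add: fun_times_form_def)
    qed
    then show ?thesis
      unfolding simplex_integral_def
      by (intro set_lebesgue_integral_cong simplex_domain_measurable) auto
  qed
  ultimately show ?thesis using that by blast
qed

lemma chain_support_subset:
  "singular_chain d (top_of_set X) \<sigma> \<Longrightarrow> chain_support d \<sigma> \<subseteq> X"
  using singular_simplex_top_of_set unfolding singular_chain_def chain_support_def by blast

lemma compact_chain_support: "singular_chain d (top_of_set X) \<sigma> \<Longrightarrow> compact (chain_support d \<sigma>)"
  unfolding chain_support_def
  using singular_simplex_top_of_set
  by (intro compact_UN compact_continuous_image compact_standard_simplex)
    (auto simp: singular_chain_def)

text \<open>The constant is the integral of the absolute value of the density
  \<open>H\<close>.\<close>

lemma bounded_functional_simplex_integral:
  fixes X :: "(complex ^ 'k::finite) set"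
  assumes \<omega>: "regular_form d X \<omega>" and s: "singular_simplex d (top_of_set X) s" "C1_simplex d s"
  obtains C where "bounded_functional {g. continuous_on X g}
    (\<lambda>g. simplex_integral d s (fun_times_form g \<omega>)) (s ` standard_simplex d) C"
proof -
  let ?M = "\<Pi>\<^sub>M i\<in>{1..d}. lborel"
  obtain H where H: "continuous_on (standard_simplex d) H"
    "\<And>g. simplex_integral d s (fun_times_form g \<omega>) =
       (LINT t : simplex_domain d | ?M. g (s (simplex_point d t)) * H (simplex_point d t))"
    using simplex_integral_regular_form[OF assms] by blast
  have s_cont: "continuous_on (standard_simplex d) s" and s_X: "s ` standard_simplex d \<subseteq> X"
    using singular_simplex_top_of_set[OF s(1)] by auto
  define C where "C = (LINT t : simplex_domain d | ?M. cmod (H (simplex_point d t)))"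
  have int: "set_integrable ?M (simplex_domain d) (\<lambda>t. g (s (simplex_point d t)) * H (simplex_point d t))"
    if "continuous_on X g" for g
    using continuous_on_compose2[OF that s_cont s_X] H(1)
    by (intro continuous_set_integrable_simplex continuous_intros)
  have int_norm: "set_integrable ?M (simplex_domain d) (\<lambda>t. cmod (H (simplex_point d t)))"
    using continuous_set_integrable_simplex[OF H(1)] by (rule set_integrable_norm)
  have "bounded_functional {g. continuous_on X g}
    (\<lambda>g. simplex_integral d s (fun_times_form g \<omega>)) (s ` standard_simplex d) C"
  proof
    fix c and g h :: "complex ^ 'k \<Rightarrow> complex"
    assume gh: "g \<in> {g. continuous_on X g}" "h \<in> {g. continuous_on X g}"
    then show "(\<lambda>x. c * g x + h x) \<in> {g. continuous_on X g}"
      by (auto intro!: continuous_intros)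
    have "simplex_integral d s (fun_times_form (\<lambda>x. c * g x + h x) \<omega>) =
      (LINT t : simplex_domain d | ?M. c * (g (s (simplex_point d t)) * H (simplex_point d t))
         + h (s (simplex_point d t)) * H (simplex_point d t))"
      unfolding H(2) by (simp add: algebra_simps)
    also have "\<dots> = c * simplex_integral d s (fun_times_form g \<omega>) + simplex_integral d s (fun_times_form h \<omega>)"
      unfolding H(2) using gh int by (subst set_integral_add) auto
    finally show "simplex_integral d s (fun_times_form (\<lambda>x. c * g x + h x) \<omega>) =
      c * simplex_integral d s (fun_times_form g \<omega>) + simplex_integral d s (fun_times_form h \<omega>)" .
  next
    fix g :: "complex ^ 'k \<Rightarrow> complex" and B :: real
    assume g: "g \<in> {g. continuous_on X g}" "0 \<le> B"
      and B: "\<And>x. x \<in> s ` standard_simplex d \<Longrightarrow> cmod (g x) \<le> B"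
    have "cmod (simplex_integral d s (fun_times_form g \<omega>))
      \<le> (LINT t : simplex_domain d | ?M. cmod (g (s (simplex_point d t)) * H (simplex_point d t)))"
      unfolding H(2) using g int by (intro set_integral_norm_bound) auto
    also have "\<dots> \<le> (LINT t : simplex_domain d | ?M. B * cmod (H (simplex_point d t)))"
      using g int int_norm B
      by (intro set_integral_mono set_integrable_norm)
        (auto simp: norm_mult open_simplex_def intro!: mult_right_mono)
    finally show "cmod (simplex_integral d s (fun_times_form g \<omega>)) \<le> C * B"
      by (simp add: C_def mult.commute)
  next
    show "0 \<le> C" unfolding C_def set_lebesgue_integral_def by (intro integral_nonneg_AE) auto
  qed auto
  then show ?thesis using that by blast
qed

text \<open>The constants of the simplices add up, weighted by the absolute values of their
  multiplicities.\<close>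

lemma bounded_functional_chain_integral:
  fixes X :: "(complex ^ 'k::finite) set"
  assumes \<omega>: "regular_form d X \<omega>" and \<sigma>: "relative_chain d X Y \<sigma>"
  obtains C where "bounded_functional {g. continuous_on X g}
    (\<lambda>g. chain_integral d \<sigma> (fun_times_form g \<omega>)) (chain_support d \<sigma>) C"
proof -
  let ?S = "Poly_Mapping.keys \<sigma>"
  have "\<exists>C. bounded_functional {g. continuous_on X g}
    (\<lambda>g. simplex_integral d s (fun_times_form g \<omega>)) (s ` standard_simplex d) C" if "s \<in> ?S" for s
  proof -
    have "singular_simplex d (top_of_set X) s" "C1_simplex d s"
      using \<sigma> that unfolding relative_chain_def singular_relcycle_def singular_chain_def by auto
    from bounded_functional_simplex_integral[OF \<omega> this] show ?thesis by metis
  qed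
  then obtain C where C: "\<And>s. s \<in> ?S \<Longrightarrow> bounded_functional {g. continuous_on X g}
    (\<lambda>g. simplex_integral d s (fun_times_form g \<omega>)) (s ` standard_simplex d) (C s)"
    by metis
  let ?c = "\<lambda>s. of_int (Poly_Mapping.lookup \<sigma> s) :: complex"
  have "bounded_functional {g. continuous_on X g}
    (\<lambda>g. chain_integral d \<sigma> (fun_times_form g \<omega>)) (chain_support d \<sigma>) (\<Sum>s\<in>?S. cmod (?c s) * C s)"
  proof
    fix c and g h :: "complex ^ 'k \<Rightarrow> complex"
    assume gh: "g \<in> {g. continuous_on X g}" "h \<in> {g. continuous_on X g}"
    then show "(\<lambda>x. c * g x + h x) \<in> {g. continuous_on X g}"
      by (auto intro!: continuous_intros)
    show "chain_integral d \<sigma> (fun_times_form (\<lambda>x. c * g x + h x) \<omega>) =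
      c * chain_integral d \<sigma> (fun_times_form g \<omega>) + chain_integral d \<sigma> (fun_times_form h \<omega>)"
      unfolding chain_integral_def sum_distrib_left sum.distrib[symmetric]
      by (intro sum.cong refl) (simp add: bounded_functional.lincomb[OF C gh], simp add: algebra_simps)
  next
    fix g :: "complex ^ 'k \<Rightarrow> complex" and B :: real
    assume g: "g \<in> {g. continuous_on X g}" "0 \<le> B"
      and B: "\<And>x. x \<in> chain_support d \<sigma> \<Longrightarrow> cmod (g x) \<le> B"
    have "cmod (chain_integral d \<sigma> (fun_times_form g \<omega>))
      \<le> (\<Sum>s\<in>?S. cmod (?c s) * cmod (simplex_integral d s (fun_times_form g \<omega>)))"
      unfolding chain_integral_def by (rule order_trans[OF norm_sum]) (simp add: norm_mult)
    also have "\<dots> \<le> (\<Sum>s\<in>?S. cmod (?c s) * (C s * B))"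
      using g B by (intro sum_mono mult_left_mono bounded_functional.bound[OF C])
        (auto simp: chain_support_def)
    finally show "cmod (chain_integral d \<sigma> (fun_times_form g \<omega>)) \<le> (\<Sum>s\<in>?S. cmod (?c s) * C s) * B"
      by (simp add: sum_distrib_right mult.assoc)
  next
    show "0 \<le> (\<Sum>s\<in>?S. cmod (?c s) * C s)"
      using bounded_functional.nonneg[OF C] by (intro sum_nonneg mult_nonneg_nonneg) auto
  qed auto
  then show ?thesis using that by blast
qed

section \<open>The analytic upper bound for the determinant\<close>

lemma norm_of_rat_complex: "cmod (of_rat q) = of_rat \<bar>q\<bar>"
proof -
  obtain u v where "quotient_of q = (u, v)" by fastforce
  then have "q = of_int u / of_int v" by (rule quotient_of_div)
  then show ?thesis by (simp add: of_rat_divide norm_divide abs_divide flip: of_int_abs)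
qed

text \<open>The maximum with 0 covers the zero chain, for which \<^const>\<open>t_sup\<close> is an unspecified supremum over
  the empty set.\<close>

lemma gram_det_le_t_sup:
  fixes X :: "(complex ^ 'k::finite) set" and f :: "complex ^ 'k \<Rightarrow> complex ^ 'r::finite"
  assumes \<omega>: "regular_form d X \<omega>" and \<sigma>: "relative_chain d X Y \<sigma>" and f: "regular_morphism X f"
  obtains C where "0 \<le> C" "\<And>N b. fact N * cmod (Determinant.det (Q_matrix d \<sigma> \<omega> f N b))
      \<le> C ^ N * (max 0 (t_sup N b (f ` chain_support d \<sigma>)))\<^sup>2"
proof -
  let ?K = "chain_support d \<sigma>"
  obtain C where "bounded_functional {g. continuous_on X g}
      (\<lambda>g. chain_integral d \<sigma> (fun_times_form g \<omega>)) ?K C"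
    using bounded_functional_chain_integral[OF \<omega> \<sigma>] by blast
  then interpret bounded_functional "{g. continuous_on X g}"
      "\<lambda>g. chain_integral d \<sigma> (fun_times_form g \<omega>)" ?K C .
  have chain: "singular_chain d (top_of_set X) \<sigma>"
    using \<sigma> by (simp add: relative_chain_def singular_relcycle_def)
  obtain F :: "'r \<Rightarrow> ('k, rat) mpoly" where F: "\<And>y i. y \<in> X \<Longrightarrow> vec_nth (f y) i = rat_eval (F i) y"
    using f unfolding regular_morphism_def by blast
  \<comment> \<open>\<open>f\<close> is given by polynomials only on \<open>X\<close>, which is why
    the functional acts on functions continuous on \<open>X\<close>.\<close>
  have f_cont: "continuous_on X (\<lambda>y. vec_nth (f y) i)" for i
  proof -
    have "continuous_on X (rat_eval (F i))" by (intro continuous_intros)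
    then show ?thesis by (simp add: F cong: continuous_on_cong)
  qed
  have b_cont: "continuous_on X (\<lambda>y. int_eval p (f y))" for p :: "('r, int) mpoly"
    by (intro continuous_intros f_cont)
  have "fact N * cmod (Determinant.det (Q_matrix d \<sigma> \<omega> f N b)) \<le> C ^ N * (max 0 (t_sup N b (f ` ?K)))\<^sup>2" for N b
    unfolding Q_matrix_def
  proof (rule gram_det_bound)
    fix z :: "nat \<Rightarrow> complex ^ 'k" assume z: "\<And>j. j < N \<Longrightarrow> z j \<in> ?K"
    let ?D = "\<lambda>z. cmod (Determinant.det (mat N N (\<lambda>(i, j). int_eval (b j) (z i))))"
    have "\<exists>B. \<forall>y\<in>?K. cmod (int_eval p (f y)) \<le> B" for p :: "('r, int) mpoly"
      using compact_imp_bounded[OF compact_continuous_image[OF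
          continuous_on_subset[OF b_cont chain_support_subset[OF chain]] compact_chain_support[OF chain]]]
      unfolding bounded_iff by auto
    then obtain B where B: "\<And>p y. y \<in> ?K \<Longrightarrow> cmod (int_eval p (f y)) \<le> B p"
      by metis
    \<comment> \<open>The permutation expansion gives a crude bound independent of the points
      \<open>w\<close>. It serves only to show that the supremum in \<open>t_sup\<close> is over a
      set bounded above, so that it dominates each value.\<close>
    have "?D w \<le> (\<Sum>p | p permutes {0..<N}. \<Prod>i = 0..<N. B (b (p i)))"
      if w: "\<forall>i<N. w i \<in> f ` ?K" for w
    proof -
      have "?D w \<le> (\<Sum>p | p permutes {0..<N}. cmod (signof p * (\<Prod>i = 0..<N. int_eval (b (p i)) (w i))))"
        unfolding det_def
        by (auto intro!: order_trans[OF norm_sum] sum_mono simp: permutes_in_image)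
      also have "\<dots> \<le> (\<Sum>p | p permutes {0..<N}. \<Prod>i = 0..<N. B (b (p i)))"
        using w B by (intro sum_mono) (auto simp: norm_mult sign_def simp flip: prod_norm intro!: prod_mono)
      finally show ?thesis .
    qed
    then have "bdd_above (?D ` {z. \<forall>i<N. z i \<in> f ` ?K})"
      by (intro bdd_aboveI2) auto
    then have "cmod (Determinant.det (mat N N (\<lambda>(i, j). int_eval (b j) (f (z i))))) \<le> t_sup N b (f ` ?K)"
      unfolding t_sup_def
      using cSUP_upper[of "\<lambda>i. f (z i)" "{z. \<forall>i<N. z i \<in> f ` ?K}" ?D] z by auto
    then show "cmod (Determinant.det (mat N N (\<lambda>(i, j). int_eval (b j) (f (z i))))) \<le> max 0 (t_sup N b (f ` ?K))"
      by simp
  qed (use b_cont in \<open>auto intro: continuous_on_mult\<close>)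
  then show ?thesis using that nonneg by blast
qed

section \<open>The arithmetic lower bound and the contradiction\<close>

lemma two_le_rat_dim:
  fixes X :: "(complex ^ 'k::finite) set" and f :: "complex ^ 'k \<Rightarrow> complex ^ 'r::finite"
    and S :: "complex set"
  assumes \<omega>: "regular_form d X \<omega>" and \<sigma>: "relative_chain d X Y \<sigma>" and f: "regular_morphism X f"
    and "finite S"
    and e: "eventually (\<lambda>n. 0 < e n) sequentially"
    and Dl: "\<And>n. Dl n \<in> GL_rat (N n)"
    and Dr: "\<And>n. Dr n \<in> GL_rat (N n)"
    and integrality: "\<And>n i j. i < N n \<Longrightarrow> j < N n \<Longrightarrow>
          (map_mat of_rat (Dl n) * Q_matrix d \<sigma> \<omega> f (N n) (b n) * map_mat of_rat (Dr n)) $$ (i, j)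
            \<in> int_span S"
    and nonzero: "infinite {N n | n. Determinant.det (Q_matrix d \<sigma> \<omega> f (N n) (b n)) \<noteq> 0}"
    and Sup_finite: "\<bar>Sup_N e N b (f ` chain_support d \<sigma>)\<bar> \<noteq> \<infinity>"
    and delta_finite: "\<bar>limsup_root e (\<lambda>n. delta (Dl n) (Dr n))\<bar> \<noteq> \<infinity>"
    and less_one: "(Sup_N e N b (f ` chain_support d \<sigma>))\<^sup>2
                     * limsup_root e (\<lambda>n. delta (Dl n) (Dr n)) < 1"
  shows "2 \<le> rat_dim (rat_span S)"
proof (rule ccontr)
  assume "\<not> 2 \<le> rat_dim (rat_span S)"
  then obtain \<eta> where "\<forall>x\<in>S. \<exists>q. x = of_rat q * \<eta>"
    using rat_dim_less_2_imp_rank_le_1[OF \<open>finite S\<close>] by auto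
  then obtain \<theta> where \<theta>: "\<And>x. x \<in> int_span S \<Longrightarrow> \<exists>k. x = of_int k * \<theta>"
    using int_span_of_rational_multiples[OF \<open>finite S\<close>] by blast
  define Q where "Q n = Q_matrix d \<sigma> \<omega> f (N n) (b n)" for n
  define t where "t n = t_sup (N n) (b n) (f ` chain_support d \<sigma>)" for n
  define \<delta> where "\<delta> n = delta (Dl n) (Dr n)" for n
  obtain C where C: "0 \<le> C" "\<And>n. fact (N n) * cmod (Determinant.det (Q n)) \<le> C ^ N n * (max 0 (t n))\<^sup>2"
    using gram_det_le_t_sup[OF \<omega> \<sigma> f] unfolding Q_def t_def by metis
  have \<delta>_pos: "0 < \<delta> n" for n
    using GL_rat_det_nonzero[OF Dl, of n] GL_rat_det_nonzero[OF Dr, of n]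
    by (simp add: \<delta>_def delta_def)
  \<comment> \<open>The scaled determinant is \<open>of_int k * \<theta> ^ N n\<close> and is
    nonzero because \<open>\<delta> n\<close> and the determinant of \<open>Q n\<close> are. So
    \<open>k\<close> is a nonzero integer, of absolute value at least 1.\<close>
  have lower: "0 < cmod \<theta> ^ N n \<and> cmod \<theta> ^ N n \<le> \<delta> n * cmod (Determinant.det (Q n))"
    if "Determinant.det (Q n) \<noteq> 0" for n
  proof -
    let ?l = "map_mat of_rat (Dl n) :: complex mat" and ?r = "map_mat of_rat (Dr n) :: complex mat"
    have carrier: "?l \<in> carrier_mat (N n) (N n)" "?r \<in> carrier_mat (N n) (N n)" "Q n \<in> carrier_mat (N n) (N n)"
      using Dl[of n] Dr[of n] by (auto simp: GL_rat_def Q_def Q_matrix_def)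
    obtain k where k: "Determinant.det (?l * Q n * ?r) = of_int k * \<theta> ^ N n"
      using det_int_multiples[of "?l * Q n * ?r" "N n" \<theta>] carrier \<theta> integrality unfolding Q_def by auto
    have "Determinant.det (?l * Q n * ?r) = of_rat (Determinant.det (Dl n) * Determinant.det (Dr n)) * Determinant.det (Q n)"
      using carrier by (simp add: det_mult[of _ "N n"] of_rat_hom.hom_det of_rat_mult)
    then have norm_det: "cmod (Determinant.det (?l * Q n * ?r)) = \<delta> n * cmod (Determinant.det (Q n))"
      by (simp only: norm_mult norm_of_rat_complex \<delta>_def delta_def)
    then have "Determinant.det (?l * Q n * ?r) \<noteq> 0"
      using \<delta>_pos[of n] that by (metis norm_eq_zero mult_eq_0_iff less_irrefl)
    then have "k \<noteq> 0" "\<theta> ^ N n \<noteq> 0"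
      unfolding k by auto
    then have \<theta>_pos: "0 < cmod \<theta> ^ N n"
      by (metis norm_power zero_less_norm_iff)
    have "1 \<le> \<bar>real_of_int k\<bar>"
      using \<open>k \<noteq> 0\<close> by linarith
    then have "1 * cmod \<theta> ^ N n \<le> \<bar>real_of_int k\<bar> * cmod \<theta> ^ N n"
      by (intro mult_right_mono) auto
    also have "\<dots> = \<delta> n * cmod (Determinant.det (Q n))"
      using norm_det unfolding k by (simp add: norm_mult norm_power)
    finally show ?thesis
      using \<theta>_pos by (simp only: mult_1)
  qed
  have "eventually (\<lambda>n. \<not> (0 < t n \<and> 0 < \<delta> n \<and> 1 \<le> (t n)\<^sup>2 * \<delta> n)) sequentially"
    using Sup_finite delta_finite less_one e unfolding Sup_N_def t_def \<delta>_def
    by (rule limsup_root_product_less_one)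
  then obtain n0 where n0: "\<And>n. n0 \<le> n \<Longrightarrow> \<not> (0 < t n \<and> 0 < \<delta> n \<and> 1 \<le> (t n)\<^sup>2 * \<delta> n)"
    unfolding eventually_sequentially by blast
  define c where "c = C / cmod \<theta>"
  have "(\<lambda>n. inverse (fact n) * c ^ n) \<longlonglongrightarrow> 0"
    by (rule summable_LIMSEQ_zero[OF summable_exp])
  then have "eventually (\<lambda>n. inverse (fact n) * c ^ n < 1) sequentially"
    by (rule order_tendstoD) simp
  then obtain N0 where N0: "\<And>k. N0 \<le> k \<Longrightarrow> inverse (fact k) * c ^ k < 1"
    unfolding eventually_sequentially by blast
  \<comment> \<open>Infinitely many ranks occur, so discarding those attained at indices below
    \<open>n0\<close> leaves arbitrarily large ones. This secures \<open>N0 \<le> N n\<close> and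
    \<open>n0 \<le> n\<close> together.\<close>
  have "infinite ({N n | n. Determinant.det (Q n) \<noteq> 0} - N ` {..<n0})"
    using nonzero unfolding Q_def by (intro Diff_infinite_finite) auto
  then obtain k where "N0 < k" "k \<in> {N n | n. Determinant.det (Q n) \<noteq> 0} - N ` {..<n0}"
    unfolding infinite_nat_iff_unbounded by blast
  then obtain n where n: "N0 \<le> N n" "Determinant.det (Q n) \<noteq> 0" "n0 \<le> n"
    by (force simp: not_less)
  let ?T = "(max 0 (t n))\<^sup>2 * \<delta> n"
  have "fact (N n) * cmod \<theta> ^ N n \<le> fact (N n) * (\<delta> n * cmod (Determinant.det (Q n)))"
    using lower[OF n(2)] by (intro mult_left_mono) auto
  also have "\<dots> = \<delta> n * (fact (N n) * cmod (Determinant.det (Q n)))" by simp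
  also have "\<dots> \<le> \<delta> n * (C ^ N n * (max 0 (t n))\<^sup>2)"
    using C(2)[of n] \<delta>_pos[of n] by (intro mult_left_mono) auto
  \<comment> \<open>Division by \<open>fact (N n) * cmod \<theta> ^ N n\<close>, which is positive
    by \<open>lower\<close>.\<close>
  finally have "1 \<le> ?T * (inverse (fact (N n)) * c ^ N n)"
    using lower[OF n(2)] by (simp add: c_def power_divide field_simps)
  also have "\<dots> \<le> ?T * 1"
    using N0[OF n(1)] \<delta>_pos[of n] by (intro mult_left_mono) auto
  finally have T: "1 \<le> ?T" by simp
  \<comment> \<open>Otherwise \<open>max 0 (t n)\<close> and hence \<open>?T\<close> would be 0.
    With \<open>t n\<close> positive the maximum disappears and \<open>n0\<close> applies.\<close>
  then have "0 < t n" by (cases "0 < t n") auto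
  with T n0[OF n(3)] \<delta>_pos[of n] show False by simp
qed

theorem corollary7p3:
  fixes d m :: nat
    and X Y :: "(complex ^ 'k::finite) set"
    and \<omega> :: "'k form"
    and \<sigma> :: "(complex ^ 'k) chain"
    and f :: "complex ^ 'k \<Rightarrow> complex ^ 'r::finite"
    and \<xi> :: "nat \<Rightarrow> complex"
    and \<N> :: "('r, int) mpoly set"
    and \<F> :: "nat \<Rightarrow> ('r, int) mpoly set"
    and N e :: "nat \<Rightarrow> nat"
    and \<mm> :: "nat \<Rightarrow> nat \<Rightarrow> ('r, int) mpoly"
    and Dl Dr :: "nat \<Rightarrow> rat mat"
  assumes X: "smooth_affine_variety d X"
    and \<omega>: "regular_form d X \<omega>"
    and Y: "divisor d X Y"
    and \<sigma>: "relative_chain d X Y \<sigma>"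
    and f: "regular_morphism X f"
    and I_real: "\<And>k :: 'r \<Rightarrow> nat.
          chain_integral d \<sigma> (fun_times_form (\<lambda>y. \<Prod>i\<in>UNIV. vec_nth (f y) i ^ k i) \<omega>) \<in> \<real>"
    and periods: "\<And>i. i \<in> {1..m} \<Longrightarrow> period (\<xi> i)"
    and I_span: "\<And>k :: 'r \<Rightarrow> nat.
          chain_integral d \<sigma> (fun_times_form (\<lambda>y. \<Prod>i\<in>UNIV. vec_nth (f y) i ^ k i) \<omega>)
            \<in> rat_span (\<xi> ` {1..m})"
    and free_infinite_rank: "\<exists>B. infinite B \<and> int_basis B \<N>"
    and admissible: "f_admissible X f \<N>"
    and increasing: "\<And>n. \<F> n \<subseteq> \<F> (Suc n)"
    and exhaustive: "(\<Union>n. \<F> n) = \<N>"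
    and submodule: "\<And>n. int_submodule (\<F> n)"
    and basis: "\<And>n. int_basis_family (N n) (\<mm> n) (\<F> n)"
    and exponents: "eventually (\<lambda>n. 0 < e n) sequentially"
    and Dl: "\<And>n. Dl n \<in> GL_rat (N n)"
    and Dr: "\<And>n. Dr n \<in> GL_rat (N n)"
    and integrality: "\<And>n i j. i < N n \<Longrightarrow> j < N n \<Longrightarrow>
          (map_mat of_rat (Dl n) * Q_matrix d \<sigma> \<omega> f (N n) (\<mm> n) * map_mat of_rat (Dr n)) $$ (i, j)
            \<in> int_span (\<xi> ` {1..m})"
    and nonzero: "infinite {N n | n. Determinant.det (Q_matrix d \<sigma> \<omega> f (N n) (\<mm> n)) \<noteq> 0}"
    and Sup_finite: "\<bar>Sup_N e N \<mm> (f ` chain_support d \<sigma>)\<bar> \<noteq> \<infinity>"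
    and delta_finite: "\<bar>limsup_root e (\<lambda>n. delta (Dl n) (Dr n))\<bar> \<noteq> \<infinity>"
    and less_one: "(Sup_N e N \<mm> (f ` chain_support d \<sigma>))\<^sup>2
                     * limsup_root e (\<lambda>n. delta (Dl n) (Dr n)) < 1"
  shows "2 \<le> rat_dim (rat_span (\<xi> ` {1..m})) \<and> (m = 2 \<and> \<xi> 1 = 1 \<longrightarrow> \<xi> 2 \<notin> \<rat>)"
proof -
  have dim: "2 \<le> rat_dim (rat_span (\<xi> ` {1..m}))"
    by (rule two_le_rat_dim[OF \<omega> \<sigma> f _ exponents Dl Dr integrality nonzero Sup_finite delta_finite less_one])
      auto
  moreover have "\<xi> 2 \<notin> \<rat>" if m: "m = 2" "\<xi> 1 = 1"
  proof
    assume "\<xi> 2 \<in> \<rat>"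
    then obtain q where "\<xi> 2 = of_rat q" by (auto elim: Rats_cases)
    \<comment> \<open>A rational second period would put both periods on the rational line through
      1, contradicting the dimension bound.\<close>
    then have "\<xi> ` {1..m} \<subseteq> rat_span {1}"
      using m by (auto simp: rat_span_singleton numeral_2_eq_2 atLeastAtMostSuc_conv intro: exI[of _ 1])
    then have "rat_dim (rat_span (\<xi> ` {1..m})) \<le> card {1 :: complex}"
      by (intro rat_vs.dim_le_card rat_vs.span_minimal) auto
    then show False using dim by simp
  qed
  ultimately show ?thesis by blast
qed

end
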